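(* Let $q$ be a prime power. Fix integers $m,n\ge1$, $r\ge0$, and a set $S\subset\{(i,j)\mid 1\le i\le m,\ 1\le j\le n\}$. Let $T_q$ be the set of $m\times n$ matrices $A$ over $\mathbf{F}_q$ with rank $r$ and support contained in the complement of $S$, and let $T_1$ be the set of $m\times n$ $0$-$1$ matrices with exactly $r$ $1$'s, no two of which lie in the same row or column, and with support contained in the complement of $S$. Then $$\#T_q\equiv\#T_1\cdot(q-1)^r\pmod{(q-1)^{r+1}}.$$
   Context: $\mathbf{F}_q$ is the field with $q$ elements. The support of a matrix $(A_{ij})$ is the set of indices $(i,j)$ such that $A_{ij}\ne0$. *)

theory Defs
  imports
    "Jordan_Normal_Form.DL_Rank"
    "HOL-Number_Theory.Cong"
    "HOL-Number_Theory.Prime_Powers"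
begin

text \<open>Rows and columns are indexed from 0, as everywhere in \<^theory>\<open>Jordan_Normal_Form.Matrix\<close>.
  The guard on the dimensions is needed because \<^term>\<open>($$)\<close> is unspecified outside them.\<close>

definition mat_support :: "'a::zero mat \<Rightarrow> (nat \<times> nat) set" where
  "mat_support A = {(i, j). i < dim_row A \<and> j < dim_col A \<and> A $$ (i, j) \<noteq> 0}"

definition rank_matrices_avoiding ::
    "nat \<Rightarrow> nat \<Rightarrow> nat \<Rightarrow> (nat \<times> nat) set \<Rightarrow> 'a::field mat set" where
  "rank_matrices_avoiding m n r S =
     {A \<in> carrier_mat m n.
        vec_space.rank m A = r \<and>
        mat_support A \<subseteq> ({..<m} \<times> {..<n}) - S}"

definition rook_matrices_avoiding ::
    "nat \<Rightarrow> nat \<Rightarrow> nat \<Rightarrow> (nat \<times> nat) set \<Rightarrow> int mat set" where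
  "rook_matrices_avoiding m n r S =
     {A \<in> carrier_mat m n.
        (\<forall>i<m. \<forall>j<n. A $$ (i, j) \<in> {0, 1}) \<and>
        card {(i, j). i < m \<and> j < n \<and> A $$ (i, j) = 1} = r \<and>
        (\<forall>i<m. \<forall>j<n. \<forall>i'<m. \<forall>j'<n.
           A $$ (i, j) = 1 \<and> A $$ (i', j') = 1 \<and> (i, j) \<noteq> (i', j') \<longrightarrow> i \<noteq> i' \<and> j \<noteq> j') \<and>
        mat_support A \<subseteq> ({..<m} \<times> {..<n}) - S}"

end

theory Submission
  imports Defs
begin

text \<open>Rescaling the rows and the columns of a matrix by nonzero factors changes neither its rank nor
  its support. The matrices of rank \<open>r\<close> are sorted by their exact support \<open>E\<close>, and for each \<open>E\<close>
  sufficiently many nonzero entries are normalised to \<open>1\<close> by rescaling: if the entries at a set \<open>F\<close> of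
  \<open>k\<close> positions in \<open>E\<close> can be multiplied by arbitrary prescribed nonzero factors, then restriction to
  \<open>F\<close> has fibres of equal size, and the number of matrices is divisible by \<open>(q - 1) ^ k\<close>
  (\<open>card_normalise_entries\<close>).

  A matrix of rank \<open>r\<close> has \<open>r\<close> nonzero entries in pairwise distinct rows and columns
  (\<open>rook_placement_subset_support\<close>). So if some matrix of rank \<open>r\<close> has support \<open>E\<close>, then \<open>E\<close>
  contains a rook placement \<open>P\<close> of size \<open>r\<close>. Either \<open>E = P\<close>, and then all \<open>(q - 1) ^ r\<close> matrices with
  support \<open>E\<close> have rank \<open>r\<close>; or \<open>E\<close> has a further position \<open>e\<close>. Seen as edges of the bipartite graph
  of rows and columns, \<open>P\<close> together with \<open>e\<close> is a matching plus one edge, hence a forest, and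
  along a forest the factors can be prescribed freely (\<open>exists_scaling_rook_insert\<close>). In this case
  the number of matrices is divisible by \<open>(q - 1) ^ (r + 1)\<close>. Summing over \<open>E\<close> leaves one term
  \<open>(q - 1) ^ r\<close> for each rook placement of size \<open>r\<close>.\<close>

section \<open>Rook placements and independent columns\<close>

text \<open>Linear independence of a family of columns, for which equal columns at different indices count
  as dependent, and which keeps the row indices so that rows can be removed.\<close>

definition independent_columns :: "('i \<Rightarrow> 'j \<Rightarrow> 'a::field) \<Rightarrow> 'i set \<Rightarrow> 'j set \<Rightarrow> bool" where
  "independent_columns a I J \<longleftrightarrow>
     (\<forall>c. (\<forall>i\<in>I. (\<Sum>j\<in>J. a i j * c j) = 0) \<longrightarrow> (\<forall>j\<in>J. c j = 0))"

definition rook_placement :: "('i \<times> 'j) set \<Rightarrow> bool" where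
  "rook_placement P \<longleftrightarrow> inj_on fst P \<and> inj_on snd P"

lemma independent_columnsD:
  assumes "independent_columns a I J" "\<And>i. i \<in> I \<Longrightarrow> (\<Sum>j\<in>J. a i j * c j) = 0" "j \<in> J"
  shows "c j = 0"
  using assms unfolding independent_columns_def by blast

text \<open>If deleting row \<open>i\<close> destroys independence, then the relations that appear form a line: any two
  of them have a combination that also vanishes in row \<open>i\<close>. Let \<open>c\<close> span this line. Its value in row
  \<open>i\<close> is nonzero, so some \<open>k\<close> has \<open>a i k * c k \<noteq> 0\<close>; since \<open>c k \<noteq> 0\<close>, no nonzero relation avoids
  column \<open>k\<close>.\<close>

lemma independent_columns_remove_row:
  assumes "finite J" and ind: "independent_columns a (insert i I) J"
    and nind: "\<not> independent_columns a I J"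
  obtains k where "k \<in> J" "a i k \<noteq> 0" "independent_columns a I (J - {k})"
proof -
  obtain c where c: "\<And>i'. i' \<in> I \<Longrightarrow> (\<Sum>j\<in>J. a i' j * c j) = 0" and "\<exists>j\<in>J. c j \<noteq> 0"
    using nind unfolding independent_columns_def by auto
  have "(\<Sum>j\<in>J. a i j * c j) \<noteq> 0"
    using ind c \<open>\<exists>j\<in>J. c j \<noteq> 0\<close> unfolding independent_columns_def by (metis insertE)
  then obtain k where k: "k \<in> J" "a i k * c k \<noteq> 0"
    by (meson sum.not_neutral_contains_not_neutral)
  have "d j = 0" if d: "\<And>i'. i' \<in> I \<Longrightarrow> (\<Sum>j\<in>J - {k}. a i' j * d j) = 0" and j: "j \<in> J - {k}" for d j
  proof -
    define d' where "d' = d(k := 0)"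
    define \<gamma> where "\<gamma> = (\<Sum>j\<in>J. a i j * c j)"
    define \<delta> where "\<delta> = (\<Sum>j\<in>J. a i j * d' j)"
    have ext: "(\<Sum>j\<in>J. a i' j * d' j) = (\<Sum>j\<in>J - {k}. a i' j * d j)" for i'
      using \<open>finite J\<close> k(1) by (subst sum.remove[of J k]) (auto simp: d'_def intro!: sum.cong)
    \<comment> \<open>This combination of the two relations vanishes in row \<open>i\<close> as well.\<close>
    have comb: "(\<Sum>j\<in>J. a i' j * (\<gamma> * d' j - \<delta> * c j)) =
        \<gamma> * (\<Sum>j\<in>J. a i' j * d' j) - \<delta> * (\<Sum>j\<in>J. a i' j * c j)" for i'
      by (simp add: sum_distrib_left sum_subtractf algebra_simps)
    have z: "\<gamma> * d' l - \<delta> * c l = 0" if "l \<in> J" for l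
    proof (rule independent_columnsD[OF ind _ that, of "\<lambda>l. \<gamma> * d' l - \<delta> * c l"])
      fix i' assume "i' \<in> insert i I"
      then show "(\<Sum>j\<in>J. a i' j * (\<gamma> * d' j - \<delta> * c j)) = 0"
        unfolding comb using c d ext by (auto simp: \<gamma>_def \<delta>_def)
    qed
    have "\<delta> = 0" using z[OF k(1)] k(2) by (auto simp: d'_def)
    moreover have "\<gamma> \<noteq> 0" using \<open>(\<Sum>j\<in>J. a i j * c j) \<noteq> 0\<close> by (simp add: \<gamma>_def)
    ultimately show "d j = 0" using z[of j] j by (auto simp: d'_def)
  qed
  then have "independent_columns a I (J - {k})"
    unfolding independent_columns_def by blast
  then show thesis using that k by auto
qed

text \<open>Rows are removed one at a time. A removed row either is redundant for independence, or is
  matched with a column at which it has a nonzero entry.\<close>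

lemma independent_columns_transversal:
  assumes "finite I" "finite J" "independent_columns a I J"
  shows "\<exists>P \<subseteq> I \<times> J. rook_placement P \<and> snd ` P = J \<and> (\<forall>(i, j)\<in>P. a i j \<noteq> 0)"
  using assms
proof (induction I arbitrary: J rule: finite_induct)
  case empty
  then have "J = {}"
    using independent_columnsD[of a "{}" J "\<lambda>_. 1"] by auto
  then show ?case by (intro exI[of _ "{}"]) (auto simp: rook_placement_def)
next
  case (insert i I)
  show ?case
  proof (cases "independent_columns a I J")
    case True
    then show ?thesis using insert.IH[OF insert.prems(1)] by blast
  next
    case False
    then obtain k where k: "k \<in> J" "a i k \<noteq> 0" "independent_columns a I (J - {k})"
      using independent_columns_remove_row insert.prems by metis
    then obtain P where P: "P \<subseteq> I \<times> (J - {k})" "rook_placement P" "snd ` P = J - {k}"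
      "\<forall>(i, j)\<in>P. a i j \<noteq> 0"
      using insert.IH[of "J - {k}"] insert.prems by auto
    have "rook_placement (insert (i, k) P)"
      using P(1,2) insert.hyps(2) unfolding rook_placement_def by force
    then show ?thesis
      using k P by (intro exI[of _ "insert (i, k) P"]) auto
  qed
qed

text \<open>The library notion of rank uses the set of columns, in which repeated columns collapse. This
  form, with column indices instead, gives access to individual entries.\<close>

lemma (in vec_space) rank_ge_iff_independent_columns:
  assumes A: "A \<in> carrier_mat n nc"
  shows "k \<le> rank A \<longleftrightarrow>
    (\<exists>J \<subseteq> {..<nc}. card J = k \<and> independent_columns (\<lambda>i j. A $$ (i, j)) {..<n} J)"
proof -
  have cols: "set (cols A) = col A ` {..<nc}"
    using A by (auto simp: cols_def)
  have carr: "col A ` J \<subseteq> carrier_vec n" for J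
    using A by auto
  have lincomb: "lincomb f (col A ` J) $ i = (\<Sum>j\<in>J. A $$ (i, j) * f (col A j))"
    if "J \<subseteq> {..<nc}" "inj_on (col A) J" "i < n" for f J i
    unfolding lincomb_index[OF that(3) carr]
    using that A by (subst sum.reindex) (auto intro!: sum.cong)
  show ?thesis
  proof
    assume "k \<le> rank A"
    obtain U where U: "maximal U (\<lambda>T. T \<subseteq> set (cols A) \<and> lin_indpt T)"
      using maximal_exists[of "(\<lambda>T. T \<subseteq> set (cols A) \<and> lin_indpt T)" "card (set (cols A))" "{}"]
      by (meson List.finite_set card_mono empty_iff empty_subsetI finite_lin_indpt2 rev_finite_subset)
    have "rank A = card U" by (rule rank_card_indpt[OF A U])
    then obtain V where V: "V \<subseteq> U" "card V = k"
      using \<open>k \<le> rank A\<close> obtain_subset_with_card_n by metis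
    have "lin_indpt V" "V \<subseteq> col A ` {..<nc}"
      using U V(1) subset_li_is_li unfolding maximal_def cols by blast+
    then obtain J where J: "J \<subseteq> {..<nc}" "inj_on (col A) J" "V = col A ` J"
      using subset_image_inj by metis
    have finJ: "finite J" using J(1) finite_subset by blast
    have "independent_columns (\<lambda>i j. A $$ (i, j)) {..<n} J"
      unfolding independent_columns_def
    proof (intro allI impI ballI, rule ccontr)
      fix c j
      assume c: "\<forall>i\<in>{..<n}. (\<Sum>j\<in>J. A $$ (i, j) * c j) = 0" and j: "j \<in> J" "c j \<noteq> 0"
      define f where "f = (\<lambda>v. c (inv_into J (col A) v))"
      have f: "f (col A j) = c j" if "j \<in> J" for j
        using J(2) that by (simp add: f_def)
      have "lincomb f V = 0\<^sub>v n"
      proof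
        show "dim_vec (lincomb f V) = dim_vec (0\<^sub>v n :: 'a vec)"
          using lincomb_dim[of V f] carr[of J] finJ J(3) by auto
        fix i assume "i < dim_vec (0\<^sub>v n :: 'a vec)"
        then show "lincomb f V $ i = 0\<^sub>v n $ i"
          using c f lincomb[OF J(1,2), of i f] J(3) by auto
      qed
      then have "lin_dep V"
        using j f finJ J(3) unfolding lin_dep_def
        by (intro exI[of _ V] exI[of _ f] exI[of _ "col A j"]) auto
      then show False using \<open>lin_indpt V\<close> by blast
    qed
    moreover have "card J = k" using J(2,3) V(2) card_image by metis
    ultimately show "\<exists>J \<subseteq> {..<nc}. card J = k \<and>
        independent_columns (\<lambda>i j. A $$ (i, j)) {..<n} J"
      using J(1) by blast
  next
    assume "\<exists>J \<subseteq> {..<nc}. card J = k \<and> independent_columns (\<lambda>i j. A $$ (i, j)) {..<n} J"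
    then obtain J where J: "J \<subseteq> {..<nc}" "card J = k"
      and ind: "independent_columns (\<lambda>i j. A $$ (i, j)) {..<n} J" by blast
    have finJ: "finite J" using J(1) finite_subset by blast
    have inj: "inj_on (col A) J"
    proof (intro inj_onI, rule ccontr)
      fix j l assume jl: "j \<in> J" "l \<in> J" "col A j = col A l" "j \<noteq> l"
      have lt: "j < nc" "l < nc" using jl(1,2) J(1) by auto
      \<comment> \<open>Two equal columns are related by the coefficients \<open>1\<close> and \<open>-1\<close>.\<close>
      define c where "c = (\<lambda>_. 0)(j := 1, l := - 1 :: 'a)"
      have "(\<Sum>x\<in>J. A $$ (i, x) * c x) = 0" if "i < n" for i
      proof -
        have "(\<Sum>x\<in>J. A $$ (i, x) * c x) = (\<Sum>x\<in>{j, l}. A $$ (i, x) * c x)"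
          using jl finJ by (intro sum.mono_neutral_right) (auto simp: c_def)
        also have "\<dots> = col A j $ i - col A l $ i"
          using jl(1,2,4) lt A that by (simp add: c_def)
        finally show ?thesis using jl(3) by simp
      qed
      then have "c j = 0"
        using independent_columnsD[OF ind _ jl(1), of c] by auto
      then show False using jl(4) by (simp add: c_def)
    qed
    have "lin_indpt (col A ` J)"
    proof
      assume "lin_dep (col A ` J)"
      then obtain f v where f: "lincomb f (col A ` J) = 0\<^sub>v n" and v: "v \<in> col A ` J" "f v \<noteq> 0"
        using finite_lin_dep[OF _ _ carr] finJ by (metis finite_imageI)
      obtain j where j: "j \<in> J" "v = col A j" using v by blast
      have "(\<Sum>j\<in>J. A $$ (i, j) * f (col A j)) = 0" if "i \<in> {..<n}" for i
        using lincomb[OF J(1) inj, of i f] f that by auto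
      then have "f (col A j) = 0"
        using independent_columnsD[OF ind _ j(1), of "\<lambda>j. f (col A j)"] by blast
      then show False using v j by simp
    qed
    then have "card (col A ` J) \<le> rank A"
      using rank_ge_card_indpt[OF A] J(1) cols by (metis image_mono)
    then show "k \<le> rank A" using inj J(2) card_image by metis
  qed
qed

text \<open>This bounds the rank from above by the support alone, and it supplies the positions that are
  normalised when the matrices of a given rank are counted.\<close>

lemma rook_placement_subset_support:
  assumes A: "A \<in> carrier_mat m n"
  obtains P where "P \<subseteq> mat_support A" "rook_placement P" "card P = vec_space.rank m A"
proof -
  obtain J where J: "J \<subseteq> {..<n}" "card J = vec_space.rank m A"
    "independent_columns (\<lambda>i j. A $$ (i, j)) {..<m} J"
    using vec_space.rank_ge_iff_independent_columns[OF A] by blast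
  have "finite J" using J(1) finite_subset by blast
  obtain P where P: "P \<subseteq> {..<m} \<times> J" "rook_placement P" "snd ` P = J"
    "\<forall>(i, j)\<in>P. A $$ (i, j) \<noteq> 0"
    using independent_columns_transversal[OF _ \<open>finite J\<close> J(3)] by auto
  have "P \<subseteq> mat_support A" using A P(1,4) J(1) by (fastforce simp: mat_support_def)
  moreover have "card P = vec_space.rank m A"
    using P(2,3) J(2) card_image unfolding rook_placement_def by metis
  ultimately show thesis using P(2) that by blast
qed

text \<open>The nonzero columns are independent, because each has its only nonzero entry in a row of its
  own.\<close>

lemma rank_rook_support:
  assumes A: "A \<in> carrier_mat m n" and rook: "rook_placement (mat_support A)"
  shows "vec_space.rank m A = card (mat_support A)"
proof (rule antisym)
  have fin: "finite (mat_support A)"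
    by (rule finite_subset[of _ "{..<dim_row A} \<times> {..<dim_col A}"]) (auto simp: mat_support_def)
  obtain P where P: "P \<subseteq> mat_support A" "rook_placement P" "card P = vec_space.rank m A"
    using rook_placement_subset_support[OF A] by blast
  show "vec_space.rank m A \<le> card (mat_support A)"
    using card_mono[OF fin P(1)] P(3) by simp
  let ?J = "snd ` mat_support A"
  have J: "?J \<subseteq> {..<n}" using A by (auto simp: mat_support_def)
  have "independent_columns (\<lambda>i j. A $$ (i, j)) {..<m} ?J"
    unfolding independent_columns_def
  proof (intro allI impI ballI)
    fix c j assume c: "\<forall>i\<in>{..<m}. (\<Sum>j\<in>?J. A $$ (i, j) * c j) = 0" and "j \<in> ?J"
    then obtain i where ij: "(i, j) \<in> mat_support A" by auto
    have "A $$ (i, l) = 0" if "l \<in> ?J - {j}" for l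
    proof (rule ccontr)
      assume "A $$ (i, l) \<noteq> 0"
      then have "(i, l) \<in> mat_support A" using ij that J A by (auto simp: mat_support_def)
      then show False using rook ij that unfolding rook_placement_def inj_on_def by fastforce
    qed
    then have "(\<Sum>l\<in>?J. A $$ (i, l) * c l) = (\<Sum>l\<in>{j}. A $$ (i, l) * c l)"
      using fin \<open>j \<in> ?J\<close> by (intro sum.mono_neutral_right) auto
    moreover have "(\<Sum>l\<in>?J. A $$ (i, l) * c l) = 0"
      using c ij A by (auto simp: mat_support_def)
    ultimately show "c j = 0" using ij by (auto simp: mat_support_def)
  qed
  moreover have "card ?J = card (mat_support A)"
    using rook card_image unfolding rook_placement_def by blast
  ultimately show "card (mat_support A) \<le> vec_space.rank m A"
    using vec_space.rank_ge_iff_independent_columns[OF A] J by blast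
qed

section \<open>Rescaling rows and columns\<close>

definition scale_mat :: "(nat \<Rightarrow> 'a) \<Rightarrow> (nat \<Rightarrow> 'a) \<Rightarrow> 'a::field mat \<Rightarrow> 'a mat" where
  "scale_mat x y A = mat (dim_row A) (dim_col A) (\<lambda>(i, j). x i * A $$ (i, j) * y j)"

lemma scale_mat_carrier [simp]: "scale_mat x y A \<in> carrier_mat m n \<longleftrightarrow> A \<in> carrier_mat m n"
  unfolding scale_mat_def carrier_mat_def by simp

lemma scale_mat_index:
  "A \<in> carrier_mat m n \<Longrightarrow> i < m \<Longrightarrow> j < n \<Longrightarrow> scale_mat x y A $$ (i, j) = x i * A $$ (i, j) * y j"
  by (auto simp: scale_mat_def)

lemma scale_mat_inverse:
  assumes "\<And>i. x i \<noteq> 0" "\<And>j. y j \<noteq> 0"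
  shows "scale_mat (inverse \<circ> x) (inverse \<circ> y) (scale_mat x y A) = A"
    and "scale_mat x y (scale_mat (inverse \<circ> x) (inverse \<circ> y) A) = A"
  using assms by (auto intro!: eq_matI simp: scale_mat_def field_simps)

lemma mat_support_scale_mat:
  assumes "\<And>i. x i \<noteq> 0" "\<And>j. y j \<noteq> 0"
  shows "mat_support (scale_mat x y A) = mat_support A"
  using assms by (auto simp: mat_support_def scale_mat_def)

lemma independent_columns_scale:
  assumes ind: "independent_columns a I J"
    and x: "\<And>i. x i \<noteq> 0" and y: "\<And>j. y j \<noteq> 0"
  shows "independent_columns (\<lambda>i j. x i * a i j * y j) I J"
  unfolding independent_columns_def
proof (intro allI impI ballI)
  fix c j assume c: "\<forall>i\<in>I. (\<Sum>j\<in>J. x i * a i j * y j * c j) = 0" and j: "j \<in> J"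
  have "(\<Sum>j\<in>J. a i j * (y j * c j)) = 0" if "i \<in> I" for i
  proof -
    have "(\<Sum>j\<in>J. x i * a i j * y j * c j) = x i * (\<Sum>j\<in>J. a i j * (y j * c j))"
      by (simp add: sum_distrib_left mult.assoc)
    then show ?thesis using c x that by simp
  qed
  then have "y j * c j = 0"
    using independent_columnsD[OF ind _ j, of "\<lambda>j. y j * c j"] by blast
  then show "c j = 0" using y by simp
qed

text \<open>Rescaling preserves independence of columns, so it cannot lower the rank; the inverse rescaling
  gives the other inequality.\<close>

lemma rank_scale_mat:
  assumes A: "A \<in> carrier_mat m n" and x: "\<And>i. x i \<noteq> 0" and y: "\<And>j. y j \<noteq> 0"
  shows "vec_space.rank m (scale_mat x y A) = vec_space.rank m A"
proof -
  have ge: "vec_space.rank m B \<le> vec_space.rank m (scale_mat u v B)"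
    if B: "B \<in> carrier_mat m n" and u: "\<And>i. u i \<noteq> 0" and v: "\<And>j. v j \<noteq> 0" for B :: "'a mat" and u v
  proof -
    obtain J where J: "J \<subseteq> {..<n}" "card J = vec_space.rank m B"
      "independent_columns (\<lambda>i j. B $$ (i, j)) {..<m} J"
      using vec_space.rank_ge_iff_independent_columns[OF B] by blast
    have "independent_columns (\<lambda>i j. scale_mat u v B $$ (i, j)) {..<m} J \<longleftrightarrow>
        independent_columns (\<lambda>i j. u i * B $$ (i, j) * v j) {..<m} J"
    proof -
      have "(\<Sum>j\<in>J. scale_mat u v B $$ (i, j) * c j) = (\<Sum>j\<in>J. u i * B $$ (i, j) * v j * c j)"
        if "i \<in> {..<m}" for i c
        using that J(1) by (intro sum.cong) (auto simp: scale_mat_index[OF B])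
      then show ?thesis unfolding independent_columns_def by simp
    qed
    then show ?thesis
      using independent_columns_scale[OF J(3) u v] J(1,2)
        vec_space.rank_ge_iff_independent_columns[of "scale_mat u v B" m n] B by auto
  qed
  have "vec_space.rank m (scale_mat x y A) \<le>
      vec_space.rank m (scale_mat (inverse \<circ> x) (inverse \<circ> y) (scale_mat x y A))"
    using A x y by (intro ge) auto
  also have "\<dots> = vec_space.rank m A"
    by (simp only: scale_mat_inverse(1)[of x y A, OF x y])
  finally show ?thesis using ge[of A x y, OF A x y] by (rule antisym)
qed

text \<open>The rook placement \<open>P\<close> alone is handled by column factors \<open>z\<close>, with every row factor \<open>1\<close>. To
  reach the prescribed value at \<open>e\<close>, only the factor of the row of \<open>e\<close> is changed; if that row
  contains a position of \<open>P\<close>, the column factor there absorbs the change. This does not disturb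
  the value at \<open>e\<close>, which lies in another column because \<open>e \<notin> P\<close>.\<close>

lemma exists_scaling_rook_insert:
  fixes t :: "'i \<times> 'j \<Rightarrow> 'a::field"
  assumes rook: "rook_placement P" and e: "e \<notin> P"
    and t: "\<And>p. p \<in> insert e P \<Longrightarrow> t p \<noteq> 0"
  shows "\<exists>x y. (\<forall>i. x i \<noteq> 0) \<and> (\<forall>j. y j \<noteq> 0) \<and>
    (\<forall>i j. (i, j) \<in> insert e P \<longrightarrow> x i * y j = t (i, j))"
proof -
  obtain i0 j0 where e_eq: "e = (i0, j0)" by fastforce
  define z where "z = (\<lambda>j. if \<exists>k. (k, j) \<in> P then t (THE p. p \<in> P \<and> snd p = j) else 1)"
  have z_eq: "z j = t (k, j)" if "(k, j) \<in> P" for k j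
  proof -
    have "(THE p. p \<in> P \<and> snd p = j) = (k, j)"
    proof (rule the_equality)
      show "p = (k, j)" if "p \<in> P \<and> snd p = j" for p
        using rook that inj_onD[of snd P p "(k, j)"] \<open>(k, j) \<in> P\<close> by (auto simp: rook_placement_def)
    qed (use that in simp)
    then show ?thesis using that by (auto simp: z_def)
  qed
  have z0: "z j \<noteq> 0" for j
  proof (cases "\<exists>k. (k, j) \<in> P")
    case True
    then show ?thesis using z_eq t by auto
  qed (simp add: z_def)
  define a where "a = t e / z j0"
  have a0: "a \<noteq> 0" using t z0 by (simp add: a_def)
  define x where "x = (\<lambda>_. 1)(i0 := a)"
  define y where "y = (\<lambda>j. if (i0, j) \<in> P then z j / a else z j)"
  have xy: "x i * y j = t (i, j)" if "(i, j) \<in> insert e P" for i j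
  proof (cases "(i, j) = e")
    case True
    then show ?thesis using e e_eq z0 by (auto simp: x_def y_def a_def)
  next
    case False
    then have ij: "(i, j) \<in> P" using that by blast
    show ?thesis
    proof (cases "i = i0")
      case True
      then show ?thesis using ij a0 z_eq[OF ij] by (simp add: x_def y_def)
    next
      case False
      then have "(i0, j) \<notin> P"
        using rook ij inj_onD[of snd P "(i, j)" "(i0, j)"] by (auto simp: rook_placement_def)
      then show ?thesis using False z_eq[OF ij] by (simp add: x_def y_def)
    qed
  qed
  have "x i \<noteq> 0" "y j \<noteq> 0" for i j using a0 z0 by (auto simp: x_def y_def)
  then show ?thesis using xy by (intro exI[of _ x] exI[of _ y]) simp
qed

text \<open>A finite \<open>P\<close> misses some position \<open>e\<close>, where the value \<open>1\<close> can be prescribed.\<close>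

lemma exists_scaling_rook:
  fixes t :: "nat \<times> nat \<Rightarrow> 'a::field"
  assumes rook: "rook_placement P" and fin: "finite P" and t: "\<And>p. p \<in> P \<Longrightarrow> t p \<noteq> 0"
  shows "\<exists>x y. (\<forall>i. x i \<noteq> 0) \<and> (\<forall>j. y j \<noteq> 0) \<and>
    (\<forall>i j. (i, j) \<in> P \<longrightarrow> x i * y j = t (i, j))"
proof -
  obtain e :: "nat \<times> nat" where e: "e \<notin> P"
    using ex_new_if_finite[OF _ fin] by (auto simp: finite_prod)
  have "(t(e := 1)) p \<noteq> 0" if "p \<in> insert e P" for p
    using that t[of p] by (cases "p = e") auto
  from exists_scaling_rook_insert[OF rook e, of "t(e := 1)", OF this] obtain x y where
    "\<forall>i. x i \<noteq> 0" "\<forall>j. y j \<noteq> 0"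
    "\<forall>i j. (i, j) \<in> insert e P \<longrightarrow> x i * y j = (t(e := 1)) (i, j)"
    by blast
  then show ?thesis
    using e by (intro exI[of _ x] exI[of _ y]) auto
qed

section \<open>Counting matrices by their support\<close>

text \<open>The factor \<open>(q - 1) ^ card F\<close> counts the possible families \<open>t\<close> of nonzero entries at \<open>F\<close>. For
  each \<open>t\<close> fix one rescaling with \<open>x i * y j = t (i, j)\<close> on \<open>F\<close>; it maps the matrices with entries \<open>1\<close>
  at \<open>F\<close> bijectively onto those with entries \<open>t\<close>.\<close>

lemma card_normalise_entries:
  fixes X :: "'a::{field,finite} mat set"
  assumes X: "X \<subseteq> carrier_mat m n" and F: "F \<subseteq> {..<m} \<times> {..<n}"
    and nz: "\<And>A p. A \<in> X \<Longrightarrow> p \<in> F \<Longrightarrow> A $$ p \<noteq> 0"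
    and closed: "\<And>A x y. A \<in> X \<Longrightarrow> (\<And>i. x i \<noteq> 0) \<Longrightarrow> (\<And>j. y j \<noteq> 0) \<Longrightarrow> scale_mat x y A \<in> X"
    and solvable: "\<And>t :: nat \<times> nat \<Rightarrow> 'a. (\<And>p. p \<in> F \<Longrightarrow> t p \<noteq> 0) \<Longrightarrow>
      \<exists>x y. (\<forall>i. x i \<noteq> 0) \<and> (\<forall>j. y j \<noteq> 0) \<and> (\<forall>i j. (i, j) \<in> F \<longrightarrow> x i * y j = t (i, j))"
  shows "card X = (card (UNIV :: 'a set) - 1) ^ card F * card {A \<in> X. \<forall>p\<in>F. A $$ p = 1}"
proof -
  define Y where "Y = {A \<in> X. \<forall>p\<in>F. A $$ p = 1}"
  define T where "T = F \<rightarrow>\<^sub>E (UNIV - {0 :: 'a})"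
  have finF: "finite F" using F finite_subset by blast
  have "\<forall>t\<in>T. \<exists>s. (\<forall>i. fst s i \<noteq> 0) \<and> (\<forall>j. snd s j \<noteq> 0) \<and>
      (\<forall>i j. (i, j) \<in> F \<longrightarrow> fst s i * snd s j = t (i, j))"
  proof
    fix t assume "t \<in> T"
    then have "t p \<noteq> 0" if "p \<in> F" for p using that by (auto simp: T_def PiE_iff)
    from solvable[of t, OF this] show "\<exists>s. (\<forall>i. fst s i \<noteq> 0) \<and> (\<forall>j. snd s j \<noteq> 0) \<and>
      (\<forall>i j. (i, j) \<in> F \<longrightarrow> fst s i * snd s j = t (i, j))" by auto
  qed
  from bchoice[OF this] obtain s where
    s: "\<forall>t\<in>T. (\<forall>i. fst (s t) i \<noteq> 0) \<and> (\<forall>j. snd (s t) j \<noteq> 0) \<and>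
      (\<forall>i j. (i, j) \<in> F \<longrightarrow> fst (s t) i * snd (s t) j = t (i, j))" ..
  define x where "x t = fst (s t)" for t
  define y where "y t = snd (s t)" for t
  have x0: "x t i \<noteq> 0" and y0: "y t j \<noteq> 0" if "t \<in> T" for t i j
    using s that by (auto simp: x_def y_def)
  have xy: "x t i * y t j = t (i, j)" if "t \<in> T" "(i, j) \<in> F" for t i j
    using s that by (auto simp: x_def y_def)
  define h where "h = (\<lambda>(t, B). scale_mat (x t) (y t) B)"
  define ent where "ent A = restrict (\<lambda>p. A $$ p) F" for A :: "'a mat"
  define g where "g A = (ent A, scale_mat (inverse \<circ> x (ent A)) (inverse \<circ> y (ent A)) A)" for A
  have entT: "ent A \<in> T" if "A \<in> X" for A
    using nz[OF that] by (auto simp: ent_def T_def)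
  have index: "scale_mat u v A $$ (i, j) = u i * v j * A $$ (i, j)"
    if "A \<in> X" "(i, j) \<in> F" for A u v i j
  proof -
    have "A \<in> carrier_mat m n" "i < m" "j < n" using that X F by auto
    then show ?thesis using scale_mat_index[of A m n i j u v] by simp
  qed
  have "bij_betw h (T \<times> Y) X"
  proof (rule bij_betw_byWitness[where f' = g])
    show "h ` (T \<times> Y) \<subseteq> X"
      using closed x0 y0 by (auto simp: h_def Y_def)
    show "\<forall>A\<in>X. h (g A) = A"
      using scale_mat_inverse(2)[OF x0 y0] entT by (simp add: h_def g_def)
    show "g ` X \<subseteq> T \<times> Y"
    proof
      fix p assume "p \<in> g ` X"
      then obtain A where A: "A \<in> X" "p = g A" by blast
      let ?B = "scale_mat (inverse \<circ> x (ent A)) (inverse \<circ> y (ent A)) A"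
      have "?B \<in> X" using closed[OF A(1)] x0 y0 entT[OF A(1)] by simp
      moreover have "?B $$ (i, j) = 1" if "(i, j) \<in> F" for i j
      proof -
        have "?B $$ (i, j) = inverse (x (ent A) i * y (ent A) j) * A $$ (i, j)"
          using index[OF A(1) that] by simp
        also have "\<dots> = inverse (A $$ (i, j)) * A $$ (i, j)"
          using xy[OF entT[OF A(1)] that] that by (simp add: ent_def)
        finally show ?thesis using nz[OF A(1) that] by simp
      qed
      ultimately have "?B \<in> Y" by (auto simp: Y_def)
      then show "p \<in> T \<times> Y" using entT[OF A(1)] A(2) by (simp add: g_def)
    qed
    show "\<forall>p\<in>T \<times> Y. g (h p) = p"
    proof
      fix p assume "p \<in> T \<times> Y"
      then obtain t B where p: "p = (t, B)" "t \<in> T" "B \<in> X" "\<forall>p\<in>F. B $$ p = 1"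
        by (auto simp: Y_def)
      have "ent (scale_mat (x t) (y t) B) = t"
      proof
        fix q show "ent (scale_mat (x t) (y t) B) q = t q"
        proof (cases "q \<in> F")
          case True
          then show ?thesis
            using index[OF p(3)] xy[OF p(2)] p(4) by (cases q) (auto simp: ent_def)
        next
          case False
          then show ?thesis using PiE_arb[of t F _ q] p(2) by (simp add: ent_def T_def)
        qed
      qed
      then show "g (h p) = p"
        using scale_mat_inverse(1)[of "x t" "y t" B] x0 y0 p(1,2) by (simp add: g_def h_def)
    qed
  qed
  then have "card X = card T * card Y"
    using bij_betw_same_card card_cartesian_product by metis
  moreover have "card T = (card (UNIV :: 'a set) - 1) ^ card F"
    using finF by (simp add: T_def card_PiE card_Diff_singleton)
  ultimately show ?thesis by (simp add: Y_def)
qed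

text \<open>If \<open>E\<close> is a rook placement of size \<open>r\<close>, then all of \<open>E\<close> is normalised, and the only matrix left
  is the indicator of \<open>E\<close>. Otherwise, as soon as there is something to count, \<open>E\<close> properly contains
  a rook placement of size \<open>r\<close>, and one more entry can be normalised.\<close>

lemma card_rank_support_cong:
  fixes E :: "(nat \<times> nat) set"
  assumes E: "E \<subseteq> {..<m} \<times> {..<n}"
  shows "[int (card {A :: 'a::{field,finite} mat. A \<in> carrier_mat m n \<and> vec_space.rank m A = r \<and> mat_support A = E})
     = (if rook_placement E \<and> card E = r then (int (card (UNIV :: 'a set)) - 1) ^ r else 0)]
     (mod (int (card (UNIV :: 'a set)) - 1) ^ (r + 1))"
proof -
  define X where "X = {A :: 'a mat. A \<in> carrier_mat m n \<and> vec_space.rank m A = r \<and> mat_support A = E}"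
  have carr: "X \<subseteq> carrier_mat m n" by (auto simp: X_def)
  have nz: "A $$ p \<noteq> 0" if "A \<in> X" "p \<in> E" for A p
    using that by (auto simp: X_def mat_support_def)
  have closed: "scale_mat x y A \<in> X" if "A \<in> X" "\<And>i. x i \<noteq> 0" "\<And>j. y j \<noteq> 0" for A x y
    using that by (auto simp: X_def rank_scale_mat mat_support_scale_mat)
  have finE: "finite E" using E finite_subset by blast
  have q: "int (card (UNIV :: 'a set) - 1) = int (card (UNIV :: 'a set)) - 1"
    by (simp add: of_nat_diff Suc_leI card_gt_0_iff)
  show ?thesis
  proof (cases "rook_placement E \<and> card E = r")
    case True
    have "card X = (card (UNIV :: 'a set) - 1) ^ card E * card {A \<in> X. \<forall>p\<in>E. A $$ p = 1}"
    proof (rule card_normalise_entries[OF carr E nz closed])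
      fix t :: "nat \<times> nat \<Rightarrow> 'a" assume "\<And>p. p \<in> E \<Longrightarrow> t p \<noteq> 0"
      then show "\<exists>x y. (\<forall>i. x i \<noteq> 0) \<and> (\<forall>j. y j \<noteq> 0) \<and> (\<forall>i j. (i, j) \<in> E \<longrightarrow> x i * y j = t (i, j))"
        using True finE by (intro exists_scaling_rook) auto
    qed
    moreover have "{A \<in> X. \<forall>p\<in>E. A $$ p = 1} = {mat m n (\<lambda>p. if p \<in> E then 1 else 0)}"
    proof -
      define B where "B = mat m n (\<lambda>p. if p \<in> E then 1 else 0 :: 'a)"
      have "mat_support B = E" using E by (auto simp: B_def mat_support_def split: if_splits)
      moreover have "B \<in> carrier_mat m n" by (simp add: B_def)
      ultimately have "B \<in> X" using rank_rook_support[of B m n] True by (simp add: X_def)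
      moreover have "B $$ p = 1" if "p \<in> E" for p using that E by (auto simp: B_def)
      moreover have "A = B" if "A \<in> X" "\<forall>p\<in>E. A $$ p = 1" for A
      proof (rule eq_matI)
        fix i j assume "i < dim_row B" "j < dim_col B"
        then show "A $$ (i, j) = B $$ (i, j)"
          using that by (cases "(i, j) \<in> E") (auto simp: X_def B_def mat_support_def)
      qed (use that in \<open>auto simp: X_def B_def\<close>)
      ultimately show ?thesis unfolding B_def[symmetric] by blast
    qed
    ultimately have "int (card X) = (int (card (UNIV :: 'a set)) - 1) ^ r"
      using True q by simp
    then show ?thesis using True unfolding X_def by simp
  next
    case False
    have "(int (card (UNIV :: 'a set)) - 1) ^ (r + 1) dvd int (card X)"
    proof (cases "X = {}")
      case nonempty: False
      then obtain A where A: "A \<in> X" by blast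
      then obtain P where P: "P \<subseteq> E" "rook_placement P" "card P = r"
        using rook_placement_subset_support[of A m n] by (auto simp: X_def)
      then have "P \<noteq> E" using False by auto
      then obtain e where e: "e \<in> E" "e \<notin> P" using P(1) by blast
      let ?F = "insert e P"
      have F: "?F \<subseteq> E" using P e by blast
      have "card X = (card (UNIV :: 'a set) - 1) ^ card ?F * card {A \<in> X. \<forall>p\<in>?F. A $$ p = 1}"
      proof (rule card_normalise_entries[OF carr _ nz closed])
        fix t :: "nat \<times> nat \<Rightarrow> 'a" assume "\<And>p. p \<in> ?F \<Longrightarrow> t p \<noteq> 0"
        then show "\<exists>x y. (\<forall>i. x i \<noteq> 0) \<and> (\<forall>j. y j \<noteq> 0) \<and> (\<forall>i j. (i, j) \<in> ?F \<longrightarrow> x i * y j = t (i, j))"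
          by (rule exists_scaling_rook_insert[OF P(2) e(2)])
      qed (use F E in auto)
      moreover have "card ?F = r + 1"
        using P e(2) finE finite_subset by (metis Suc_eq_plus1 card_insert_disjoint)
      ultimately have "int (card X) = (int (card (UNIV :: 'a set)) - 1) ^ (r + 1) * int (card {A \<in> X. \<forall>p\<in>?F. A $$ p = 1})"
        using q by simp
      then show ?thesis by simp
    qed simp
    then show ?thesis using False unfolding X_def by (simp only: if_False cong_0_iff)
  qed
qed

lemma card_rook_matrices_avoiding:
  "card (rook_matrices_avoiding m n r S) =
     card {P. P \<subseteq> ({..<m} \<times> {..<n}) - S \<and> rook_placement P \<and> card P = r}"
proof (rule bij_betw_same_card)
  define ind where "ind P = mat m n (\<lambda>p. if p \<in> P then 1 else 0 :: int)" for P
  have supp_ind: "mat_support (ind P) = P" if "P \<subseteq> {..<m} \<times> {..<n}" for P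
    using that by (auto simp: ind_def mat_support_def split: if_splits)
  have ones: "mat_support A = {(i, j). i < m \<and> j < n \<and> A $$ (i, j) = 1}"
    if "A \<in> carrier_mat m n" "\<forall>i<m. \<forall>j<n. A $$ (i, j) \<in> {0, 1}" for A :: "int mat"
    using that by (auto simp: mat_support_def)
  have rook: "rook_placement {(i, j). i < m \<and> j < n \<and> A $$ (i, j) = 1} \<longleftrightarrow>
      (\<forall>i<m. \<forall>j<n. \<forall>i'<m. \<forall>j'<n.
        A $$ (i, j) = 1 \<and> A $$ (i', j') = 1 \<and> (i, j) \<noteq> (i', j') \<longrightarrow> i \<noteq> i' \<and> j \<noteq> j')" for A :: "int mat"
    by (auto simp: rook_placement_def inj_on_def)
  have rook_iff: "A \<in> rook_matrices_avoiding m n r S \<longleftrightarrow>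
      A \<in> carrier_mat m n \<and> (\<forall>i<m. \<forall>j<n. A $$ (i, j) \<in> {0, 1}) \<and>
      card {(i, j). i < m \<and> j < n \<and> A $$ (i, j) = 1} = r \<and>
      rook_placement {(i, j). i < m \<and> j < n \<and> A $$ (i, j) = 1} \<and>
      mat_support A \<subseteq> ({..<m} \<times> {..<n}) - S" for A
    unfolding rook_matrices_avoiding_def mem_Collect_eq rook ..
  show "bij_betw mat_support (rook_matrices_avoiding m n r S)
      {P. P \<subseteq> ({..<m} \<times> {..<n}) - S \<and> rook_placement P \<and> card P = r}"
  proof (rule bij_betw_byWitness[where f' = ind])
    show "\<forall>A\<in>rook_matrices_avoiding m n r S. ind (mat_support A) = A"
    proof
      fix A assume "A \<in> rook_matrices_avoiding m n r S"
      then have A: "A \<in> carrier_mat m n" "\<forall>i<m. \<forall>j<n. A $$ (i, j) \<in> {0, 1}"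
        by (simp_all add: rook_matrices_avoiding_def)
      show "ind (mat_support A) = A"
      proof (rule eq_matI)
        fix i j assume "i < dim_row A" "j < dim_col A"
        then have "i < m" "j < n" "A $$ (i, j) = 0 \<or> A $$ (i, j) = 1" using A by auto
        then show "ind (mat_support A) $$ (i, j) = A $$ (i, j)"
          using A(1) by (auto simp: ind_def mat_support_def)
      qed (use A(1) in \<open>auto simp: ind_def\<close>)
    qed
    show "\<forall>P\<in>{P. P \<subseteq> ({..<m} \<times> {..<n}) - S \<and> rook_placement P \<and> card P = r}.
        mat_support (ind P) = P"
      using supp_ind by blast
    show "mat_support ` rook_matrices_avoiding m n r S \<subseteq>
        {P. P \<subseteq> ({..<m} \<times> {..<n}) - S \<and> rook_placement P \<and> card P = r}"
    proof
      fix P assume "P \<in> mat_support ` rook_matrices_avoiding m n r S"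
      then obtain A where A: "A \<in> rook_matrices_avoiding m n r S" "P = mat_support A" by blast
      note A_rook = A(1)[unfolded rook_iff]
      have "mat_support A = {(i, j). i < m \<and> j < n \<and> A $$ (i, j) = 1}"
        by (rule ones[OF conjunct1[OF A_rook] conjunct1[OF conjunct2[OF A_rook]]])
      then show "P \<in> {P. P \<subseteq> ({..<m} \<times> {..<n}) - S \<and> rook_placement P \<and> card P = r}"
        using A_rook unfolding A(2) mem_Collect_eq by metis
    qed
    show "ind ` {P. P \<subseteq> ({..<m} \<times> {..<n}) - S \<and> rook_placement P \<and> card P = r} \<subseteq>
        rook_matrices_avoiding m n r S"
    proof
      fix A assume "A \<in> ind ` {P. P \<subseteq> ({..<m} \<times> {..<n}) - S \<and> rook_placement P \<and> card P = r}"
      then obtain P where P: "P \<subseteq> ({..<m} \<times> {..<n}) - S" "rook_placement P" "card P = r"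
        and A: "A = ind P" by blast
      have supp: "mat_support A = P" using supp_ind P(1) A by blast
      have 01: "A \<in> carrier_mat m n" "\<forall>i<m. \<forall>j<n. A $$ (i, j) \<in> {0, 1}"
        by (auto simp: A ind_def)
      show "A \<in> rook_matrices_avoiding m n r S"
        unfolding rook_iff ones[OF 01, symmetric] supp using 01 P by (intro conjI)
    qed
  qed
qed

text \<open>Entries outside the dimensions are unspecified, so a matrix is determined by the restriction of
  its entry function to the index range.\<close>

lemma finite_carrier_mat: "finite (carrier_mat m n :: 'a::{finite} mat set)"
proof (rule finite_imageD)
  let ?f = "\<lambda>A :: 'a mat. restrict (\<lambda>p. A $$ p) ({..<m} \<times> {..<n})"
  have "?f ` carrier_mat m n \<subseteq> ({..<m} \<times> {..<n}) \<rightarrow>\<^sub>E UNIV"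
    unfolding image_subset_iff restrict_PiE_iff by simp
  then show "finite (?f ` carrier_mat m n)"
    by (rule finite_subset) (auto intro: finite_PiE)
  show "inj_on ?f (carrier_mat m n)"
  proof (intro inj_onI eq_matI)
    fix A B :: "'a mat" and i j
    assume AB: "A \<in> carrier_mat m n" "B \<in> carrier_mat m n" "?f A = ?f B"
      "i < dim_row B" "j < dim_col B"
    have "?f A (i, j) = ?f B (i, j)" by (rule fun_cong[OF AB(3)])
    then show "A $$ (i, j) = B $$ (i, j)" using AB(1,2,4,5) by simp
  qed auto
qed

theorem proposition5p1:
  fixes q m n r :: nat and S :: "(nat \<times> nat) set"
  assumes "primepow q"
    and "card (UNIV :: 'a::{field,finite} set) = q"
    and "m \<ge> 1" and "n \<ge> 1"
    and "S \<subseteq> {..<m} \<times> {..<n}"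
  shows "[int (card (rank_matrices_avoiding m n r S :: 'a mat set))
            = int (card (rook_matrices_avoiding m n r S)) * (int q - 1) ^ r]
          (mod (int q - 1) ^ (r + 1))"
proof -
  define C where "C = ({..<m} \<times> {..<n}) - S"
  define X where "X E = {A :: 'a mat. A \<in> carrier_mat m n \<and> vec_space.rank m A = r \<and> mat_support A = E}"
    for E
  have finC: "finite C" by (simp add: C_def)
  have "rank_matrices_avoiding m n r S = (\<Union>E\<in>Pow C. X E)"
    by (auto simp: rank_matrices_avoiding_def X_def C_def)
  moreover have "card (\<Union>E\<in>Pow C. X E) = (\<Sum>E\<in>Pow C. card (X E))"
    using finC finite_carrier_mat
    by (intro card_UN_disjoint) (auto simp: X_def intro: finite_subset[OF _ finite_carrier_mat[of m n]])
  ultimately have "int (card (rank_matrices_avoiding m n r S :: 'a mat set)) =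
      (\<Sum>E\<in>Pow C. int (card (X E)))" by simp
  also have "[\<dots> = (\<Sum>E\<in>Pow C. if rook_placement E \<and> card E = r then (int q - 1) ^ r else 0)]
      (mod (int q - 1) ^ (r + 1))"
  proof (rule cong_sum)
    fix E assume "E \<in> Pow C"
    then have "E \<subseteq> {..<m} \<times> {..<n}" by (auto simp: C_def)
    from card_rank_support_cong[OF this, of r, where 'a = 'a]
    show "[int (card (X E)) = (if rook_placement E \<and> card E = r then (int q - 1) ^ r else 0)]
        (mod (int q - 1) ^ (r + 1))"
      unfolding X_def assms(2) .
  qed
  also have "(\<Sum>E\<in>Pow C. if rook_placement E \<and> card E = r then (int q - 1) ^ r else 0) =
      int (card {E. E \<subseteq> C \<and> rook_placement E \<and> card E = r}) * (int q - 1) ^ r"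
    using finC by (simp add: sum.If_cases Int_def)
  also have "card {E. E \<subseteq> C \<and> rook_placement E \<and> card E = r} = card (rook_matrices_avoiding m n r S)"
    unfolding card_rook_matrices_avoiding C_def ..
  finally show ?thesis .
qed

end
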